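(* Let $m$ be squarefree, let $n=n(m)$ denote the number of odd prime divisors of $m$, and let $A\subset\mathbb{Z}_m$ be such that $A-A$ does not contain non-zero squares. As $m\to\infty$: (i) if $n=o\left(\frac{\log m}{\log\log m}\right)$, then $|A|\leq m^{1/2+o(1)}$; (ii) if $\varepsilon>0$ is fixed and $n\leq\left(\frac13-\varepsilon\right)\frac{\log m}{\log\log m}$, then $|A|\leq m^{1-1.5\varepsilon+o(1)}$.
   Context: $\mathbb{Z}_m=\mathbb{Z}/m\mathbb{Z}$. An element $x\in\mathbb{Z}_m$ is a square if $x=y^2$ for some $y\in\mathbb{Z}_m$ ($y$ need not be invertible). $A-A=\{a-b: a,b\in A\}$; the condition on $A$ means that $a-b$ is not a square in $\mathbb{Z}_m$ for all distinct $a,b\in A$. The asymptotic notation refers to $m\to\infty$ along squarefree integers satisfying the respective hypothesis on $n$. Explicitly, (i) means: for every sequence of squarefree integers $m_k\to\infty$ with $n(m_k)\log\log m_k/\log m_k\to0$ and every choice of sets $A_k\subset\mathbb{Z}_{m_k}$ with the stated property, for each $\delta>0$ one has $|A_k|\leq m_k^{1/2+\delta}$ for all sufficiently large $k$. And (ii) means: for every fixed $\varepsilon>0$ and every $\delta>0$ there is $m_0$ such that $|A|\leq m^{1-1.5\varepsilon+\delta}$ for every squarefree $m\geq m_0$ satisfying the hypothesis on $n$ in (ii) and every $A\subset\mathbb{Z}_m$ with the stated property. *)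

theory Defs
  imports
    Complex_Main
    "HOL-Computational_Algebra.Squarefree"
    "HOL-Number_Theory.Residues"
begin

definition ring_square :: "('a, 'b) ring_scheme \<Rightarrow> 'a \<Rightarrow> bool" where
  "ring_square R x \<longleftrightarrow> (\<exists>y\<in>carrier R. x = y [^]\<^bsub>R\<^esub> (2::nat))"

definition difference_set :: "('a, 'b) ring_scheme \<Rightarrow> 'a set \<Rightarrow> 'a set" where
  "difference_set R A = {a \<ominus>\<^bsub>R\<^esub> b | a b. a \<in> A \<and> b \<in> A}"

definition no_nonzero_square_differences :: "('a, 'b) ring_scheme \<Rightarrow> 'a set \<Rightarrow> bool" where
  "no_nonzero_square_differences R A \<longleftrightarrow>
     (\<forall>x\<in>difference_set R A. x \<noteq> \<zero>\<^bsub>R\<^esub> \<longrightarrow> \<not> ring_square R x)"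

definition num_odd_prime_divisors :: "nat \<Rightarrow> nat" where
  "num_odd_prime_divisors m = card {p. prime p \<and> odd p \<and> p dvd m}"

text \<open>The modulus 1 is excluded here only because the locale \<open>residues\<close> excludes it.\<close>

lemma no_nonzero_square_differences_residue_ring:
  assumes "m > 1" "A \<subseteq> carrier (residue_ring m)"
  shows "no_nonzero_square_differences (residue_ring m) A \<longleftrightarrow>
    (\<forall>a\<in>A. \<forall>b\<in>A. a \<noteq> b \<longrightarrow> \<not> (\<exists>y. [a - b = y ^ 2] (mod m)))"
proof -
  interpret residues m "residue_ring m"
    using assms(1) by unfold_locales auto
  have diff: "a \<ominus>\<^bsub>residue_ring m\<^esub> b = (a - b) mod m" if "a \<in> A" "b \<in> A" for a b
    by (simp add: a_minus_def res_add_eq res_neg_eq mod_add_right_eq)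
  have sq: "ring_square (residue_ring m) (x mod m) \<longleftrightarrow> (\<exists>y. [x = y ^ 2] (mod m))" for x
  proof
    assume "ring_square (residue_ring m) (x mod m)"
    then show "\<exists>y. [x = y ^ 2] (mod m)"
      by (auto simp: ring_square_def cong_def numeral_2_eq_2 res_mult_eq res_one_eq mod_mult_left_eq)
  next
    assume "\<exists>y. [x = y ^ 2] (mod m)"
    then obtain y where "x mod m = y ^ 2 mod m"
      by (auto simp: cong_def)
    then have "x mod m = (y mod m) [^]\<^bsub>residue_ring m\<^esub> (2::nat)"
      by (simp add: pow_cong)
    moreover have "y mod m \<in> carrier (residue_ring m)"
      by simp
    ultimately show "ring_square (residue_ring m) (x mod m)"
      unfolding ring_square_def by blast
  qed
  have zero: "(a - b) mod m = 0 \<longleftrightarrow> a = b" if "a \<in> A" "b \<in> A" for a b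
  proof -
    have "0 \<le> a" "a < m" "0 \<le> b" "b < m"
      using that assms(2) by (auto simp: residue_ring_def)
    then show ?thesis
      by (metis mod_eq_dvd_iff mod_pos_pos_trivial dvd_eq_mod_eq_0)
  qed
  have set: "difference_set (residue_ring m) A = {(a - b) mod m | a b. a \<in> A \<and> b \<in> A}"
    unfolding difference_set_def using diff by (metis (no_types, lifting))
  show ?thesis
    unfolding no_nonzero_square_differences_def set res_zero_eq
    using sq zero by blast
qed

end

theory Submission
  imports Defs "HOL-Analysis.Analysis"
begin

text \<open>
  The two asymptotic statements follow from an explicit inequality: if \<open>m\<close> is squarefree with \<open>n\<close>
  odd prime divisors, then \<open>card A \<le> sqrt m * (3 * n) ^ n\<close>. The factor \<open>(3 * n) ^ n\<close> is at most
  \<open>exp (n * ln (ln m))\<close> as soon as \<open>3 * n \<le> ln m\<close>, hence it is \<open>m powr o(1)\<close> in the first case and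
  at most \<open>m powr (1/3 - \<epsilon>)\<close> in the second; there \<open>1/2 + (1/3 - \<epsilon>) \<le> 1 - 1.5 * \<epsilon>\<close>, because the
  hypothesis forces \<open>\<epsilon> \<le> 1/3\<close>.

  The inequality is proved by a positivity argument of Delsarte type. For an odd prime \<open>p\<close> dividing
  \<open>m\<close> let \<open>f\<^sub>p x = K\<^sub>p * [p dvd x] + card {y mod p. y\<^sup>2 = x}\<close>, with \<open>K\<^sub>p = 2 * n * sqrt p\<close>. It
  vanishes off the squares mod \<open>p\<close> and \<open>f\<^sub>p 0 = K\<^sub>p + 1\<close>. By the Chinese remainder theorem every
  nonsquare mod \<open>m\<close> is a nonsquare modulo some odd \<open>p\<close>, so for \<open>a, b\<close> in \<open>A\<close> the product over \<open>p\<close> of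
  \<open>f\<^sub>p (a - b)\<close> is zero unless \<open>a = b\<close>, and summing it over all pairs gives
  \<open>card A * (\<Prod>p. K\<^sub>p + 1)\<close>.

  On the other hand, expand each \<open>f\<^sub>p\<close> in additive characters. The same sum becomes a combination of
  squared moduli of exponential sums over \<open>A\<close>, whose coefficients are the products over \<open>p\<close> of the
  Fourier coefficients \<open>(K\<^sub>p + S\<^sub>p t) / p\<close>, where \<open>S\<^sub>p t\<close> is a quadratic Gauss sum. Its modulus is
  \<open>sqrt p\<close> for \<open>t \<noteq> 0\<close> (lemma \<open>norm_quad_sum\<close>), so each coefficient is a nonnegative real times
  \<open>1 + w\<close> with \<open>norm w \<le> 1 / (2 * n)\<close>. A product of \<open>n\<close> such factors has nonnegative real part
  (lemma \<open>Re_prod_near_1_nonneg\<close>): this is what the size of \<open>K\<^sub>p\<close> is chosen for. It is needed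
  since \<open>S\<^sub>p t\<close> is purely imaginary when \<open>p mod 4 = 3\<close>, and the phases of different primes add up.
  Keeping only the term with all frequencies zero, which is at least \<open>(card A)\<^sup>2\<close>, yields
  \<open>card A \<le> (\<Prod>p. K\<^sub>p + 1)\<close> (lemma \<open>card_le_prod\<close>).
\<close>

section \<open>Additive characters and quadratic Gauss sums\<close>

definition addchar :: "nat \<Rightarrow> int \<Rightarrow> complex" where
  "addchar p k = cis (2 * pi * (real_of_int k / real p))"

lemma addchar_0 [simp]: "addchar p 0 = 1"
  by (simp add: addchar_def)

lemma addchar_add: "addchar p (a + b) = addchar p a * addchar p b"
  by (simp add: addchar_def cis_mult add_divide_distrib ring_distribs)

lemma addchar_minus: "addchar p (- a) = cnj (addchar p a)"
  by (simp add: addchar_def cis_cnj)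

lemma addchar_diff: "addchar p (a - b) = addchar p a * cnj (addchar p b)"
  using addchar_add[of p a "- b"] by (simp add: addchar_minus)

lemma addchar_power: "addchar p (int n * a) = addchar p a ^ n"
  by (induction n) (auto simp: addchar_add ring_distribs)

lemma addchar_eq_1_iff:
  assumes "p > 0"
  shows "addchar p a = 1 \<longleftrightarrow> int p dvd a"
proof
  assume "addchar p a = 1"
  then have "exp (\<i> * of_real (2 * pi * (real_of_int a / real p))) = 1"
    by (simp add: addchar_def cis_conv_exp)
  then obtain n :: int where "2 * pi * (real_of_int a / real p) = of_int (2 * n) * pi"
    unfolding exp_eq_1 by auto
  then have "(real_of_int a / real p) * (2 * pi) = of_int n * (2 * pi)"
    by (simp only: of_int_mult of_int_numeral mult_ac)
  then have "real_of_int a / real p = of_int n"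
    unfolding mult_cancel_right using pi_neq_zero by simp
  then have "real_of_int a = of_int (int p * n)"
    using assms by (simp add: field_simps)
  then have "a = int p * n"
    by linarith
  then show "int p dvd a"
    by simp
next
  assume "int p dvd a"
  then obtain n where "a = int p * n"
    by auto
  then have "addchar p a = cis (2 * pi * of_int n)"
    using assms by (simp add: addchar_def)
  then show "addchar p a = 1"
    using cis_multiple_2pi[of "of_int n"] by simp
qed

lemma sum_addchar:
  assumes "p > 0"
  shows "(\<Sum>t<p. addchar p (int t * a)) = (if int p dvd a then of_nat p else 0)"
proof (cases "int p dvd a")
  case True
  then have "addchar p a = 1"
    using addchar_eq_1_iff assms by simp
  with True show ?thesis
    by (simp add: addchar_power)
next
  case False
  have "addchar p a ^ p = 1"
    using addchar_eq_1_iff[of p "int p * a"] assms by (simp add: addchar_power)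
  moreover have "addchar p a \<noteq> 1"
    using False addchar_eq_1_iff assms by simp
  ultimately show ?thesis
    using False by (simp add: addchar_power geometric_sum)
qed

lemma sum_shift_periodic:
  fixes h :: "nat \<Rightarrow> 'a :: ab_group_add"
  assumes "\<And>y. h (y + p) = h y"
  shows "(\<Sum>y<p. h (y + z)) = (\<Sum>y<p. h y)"
proof (induction z)
  case (Suc z)
  have "h z + (\<Sum>y<p. h (y + Suc z)) = (\<Sum>y<Suc p. h (y + z))"
    by (subst sum.lessThan_Suc_shift) simp
  also have "\<dots> = (\<Sum>y<p. h (y + z)) + h z"
    using assms[of z] by (simp add: add.commute)
  finally show ?case
    using Suc by (simp add: add.commute)
qed simp

text \<open>The sign is the one that occurs in the Fourier coefficients of \<open>x \<mapsto> card {y. y\<^sup>2 = x}\<close>.\<close>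

definition quad_sum :: "nat \<Rightarrow> nat \<Rightarrow> complex" where
  "quad_sum p t = (\<Sum>y<p. addchar p (- (int t * (int y)\<^sup>2)))"

lemma quad_sum_0 [simp]: "quad_sum p 0 = of_nat p"
  by (simp add: quad_sum_def)

text \<open>
  In the double sum for the squared modulus put \<open>y = u + z\<close>: the exponent becomes linear in \<open>z\<close>, with
  slope a multiple of \<open>2 * t * u\<close>, so orthogonality leaves only \<open>u = 0\<close>.
\<close>

lemma norm_quad_sum:
  assumes "prime p" "odd p" "0 < t" "t < p"
  shows "norm (quad_sum p t) = sqrt (real p)"
proof -
  have p: "p > 0"
    using assms by linarith
  have cop: "\<not> p dvd 2 * t"
    using assms by (metis coprime_commute coprime_dvd_mult_right_iff nat_dvd_not_less
        coprime_right_2_iff_odd)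
  define c where "c = int t"
  have per: "addchar p (- (c * (int (y + p))\<^sup>2)) = addchar p (- (c * (int y)\<^sup>2))" for y
  proof -
    have "- (c * (int (y + p))\<^sup>2) = - (c * (int y)\<^sup>2) + int p * (- c * (2 * int y + int p))"
      by (simp add: power2_eq_square algebra_simps)
    moreover have "addchar p (int p * (- c * (2 * int y + int p))) = 1"
      using addchar_eq_1_iff[OF p] by simp
    ultimately show ?thesis
      by (simp only: addchar_add mult_1_right)
  qed
  have "complex_of_real ((norm (quad_sum p t))\<^sup>2) = quad_sum p t * cnj (quad_sum p t)"
    by (rule complex_norm_square)
  also have "\<dots> = (\<Sum>z<p. (\<Sum>y<p. addchar p (- (c * (int y)\<^sup>2))) * cnj (addchar p (- (c * (int z)\<^sup>2))))"
    by (simp add: quad_sum_def c_def sum_distrib_left)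
  also have "\<dots> = (\<Sum>z<p. (\<Sum>u<p. addchar p (- (c * (int (u + z))\<^sup>2))) * cnj (addchar p (- (c * (int z)\<^sup>2))))"
    by (simp only: sum_shift_periodic[of "\<lambda>y. addchar p (- (c * (int y)\<^sup>2))" p, OF per])
  also have "\<dots> = (\<Sum>z<p. \<Sum>u<p. addchar p (- (c * (int u)\<^sup>2)) * addchar p (int z * (- (2 * c * int u))))"
    unfolding sum_distrib_right
  proof (intro sum.cong refl)
    fix z u
    have "- (c * (int (u + z))\<^sup>2) - - (c * (int z)\<^sup>2) = - (c * (int u)\<^sup>2) + int z * (- (2 * c * int u))"
      by (simp add: power2_eq_square algebra_simps)
    then show "addchar p (- (c * (int (u + z))\<^sup>2)) * cnj (addchar p (- (c * (int z)\<^sup>2))) =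
        addchar p (- (c * (int u)\<^sup>2)) * addchar p (int z * (- (2 * c * int u)))"
      by (metis addchar_add addchar_diff)
  qed
  also have "\<dots> = (\<Sum>u<p. addchar p (- (c * (int u)\<^sup>2)) * (\<Sum>z<p. addchar p (int z * (- (2 * c * int u)))))"
    by (subst sum.swap) (simp add: sum_distrib_left)
  also have "\<dots> = (\<Sum>u<p. if u = 0 then of_nat p else 0)"
  proof (intro sum.cong refl)
    fix u assume u: "u \<in> {..<p}"
    have "int p dvd - (2 * c * int u) \<longleftrightarrow> p dvd (2 * t) * u"
      unfolding c_def dvd_minus_iff by (metis int_dvd_int_iff of_nat_mult of_nat_numeral)
    also have "\<dots> \<longleftrightarrow> p dvd u"
      using cop assms(1) prime_dvd_mult_iff by blast
    also have "\<dots> \<longleftrightarrow> u = 0"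
      using u by (auto dest: dvd_imp_le)
    finally show "addchar p (- (c * (int u)\<^sup>2)) * (\<Sum>z<p. addchar p (int z * (- (2 * c * int u)))) =
        (if u = 0 then of_nat p else 0)"
      unfolding sum_addchar[OF p] by simp
  qed
  also have "\<dots> = of_real (real p)"
    using p by simp
  finally have "(norm (quad_sum p t))\<^sup>2 = real p"
    by (simp only: of_real_eq_iff)
  then show ?thesis
    by (metis norm_ge_zero real_sqrt_abs abs_of_nonneg)
qed

section \<open>A weight supported on the squares modulo a prime\<close>

text \<open>
  The weight is defined by its Fourier expansion; lemma \<open>square_weight_eq\<close> gives its values.
\<close>

definition weight_coeff :: "real \<Rightarrow> nat \<Rightarrow> nat \<Rightarrow> complex" where
  "weight_coeff K p t = (of_real K + quad_sum p t) / of_nat p"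

definition square_weight :: "real \<Rightarrow> nat \<Rightarrow> int \<Rightarrow> complex" where
  "square_weight K p x = (\<Sum>t<p. weight_coeff K p t * addchar p (int t * x))"

lemma square_weight_eq:
  assumes "p > 0"
  shows "square_weight K p x =
    (if int p dvd x then of_real K else 0) + of_nat (card {y. y < p \<and> [x = (int y)\<^sup>2] (mod int p)})"
proof -
  have "(\<Sum>t<p. quad_sum p t * addchar p (int t * x)) =
      (\<Sum>t<p. \<Sum>y<p. addchar p (int t * (x - (int y)\<^sup>2)))"
    unfolding quad_sum_def sum_distrib_right
    by (intro sum.cong refl) (simp add: addchar_add[symmetric] algebra_simps)
  also have "\<dots> = (\<Sum>y<p. if [x = (int y)\<^sup>2] (mod int p) then of_nat p else 0)"
    by (subst sum.swap) (simp add: sum_addchar[OF assms] cong_iff_dvd_diff)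
  also have "\<dots> = of_nat p * of_nat (card {y. y < p \<and> [x = (int y)\<^sup>2] (mod int p)})"
    by (simp add: sum.If_cases lessThan_def Int_def conj_commute)
  finally have 1: "(\<Sum>t<p. quad_sum p t * addchar p (int t * x)) = \<dots>" .
  have "of_nat p * square_weight K p x = (\<Sum>t<p. (of_real K + quad_sum p t) * addchar p (int t * x))"
    using assms by (simp add: square_weight_def weight_coeff_def sum_distrib_left)
  also have "\<dots> = of_real K * (\<Sum>t<p. addchar p (int t * x)) + (\<Sum>t<p. quad_sum p t * addchar p (int t * x))"
    by (simp add: ring_distribs sum.distrib sum_distrib_left)
  also have "\<dots> = of_nat p * ((if int p dvd x then of_real K else 0) +
      of_nat (card {y. y < p \<and> [x = (int y)\<^sup>2] (mod int p)}))"
    unfolding 1 sum_addchar[OF assms] by (simp add: algebra_simps)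
  finally show ?thesis
    using assms by (metis mult_cancel_left of_nat_eq_0_iff less_not_refl)
qed

lemma square_weight_0:
  assumes "prime p"
  shows "square_weight K p 0 = of_real (K + 1)"
proof -
  have "{y. y < p \<and> [0 = (int y)\<^sup>2] (mod int p)} = {0}"
  proof -
    have "y = 0" if "y < p" "[0 = (int y)\<^sup>2] (mod int p)" for y
    proof -
      have "int p dvd int y ^ 2"
        using that(2) by (meson cong_0_iff cong_sym)
      then have "p dvd y"
        by (metis assms int_dvd_int_iff of_nat_power prime_dvd_power)
      then show ?thesis
        using that(1) by (auto dest: dvd_imp_le)
    qed
    then show ?thesis
      using assms by (auto simp: prime_gt_0_nat)
  qed
  then show ?thesis
    using assms by (simp add: square_weight_eq prime_gt_0_nat)
qed

lemma square_weight_nonsquare: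
  assumes "p > 0" "\<not> (\<exists>y. [x = y\<^sup>2] (mod int p))"
  shows "square_weight K p x = 0"
proof -
  have "\<not> int p dvd x"
  proof
    assume "int p dvd x"
    then have "[x = 0\<^sup>2] (mod int p)"
      by (simp add: cong_0_iff)
    then show False
      using assms(2) by blast
  qed
  moreover have "{y. y < p \<and> [x = (int y)\<^sup>2] (mod int p)} = {}"
    using assms(2) by blast
  ultimately show ?thesis
    using assms(1) by (simp add: square_weight_eq)
qed

lemma weight_coeff_0: "weight_coeff K p 0 = of_real ((K + real p) / real p)"
  by (simp add: weight_coeff_def)

section \<open>Positivity of the products of Fourier coefficients\<close>

text \<open>
  Expanding the product shows that it differs from 1 by at most
  \<open>(1 + 1 / (2 * n)) ^ n - 1 \<le> exp (1/2) - 1 < 1\<close>, where \<open>n = card P\<close>.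
\<close>

lemma Re_prod_near_1_nonneg:
  fixes w :: "nat \<Rightarrow> complex"
  assumes "finite P" "\<And>p. p \<in> P \<Longrightarrow> norm (w p) \<le> 1 / (2 * real (card P))"
  shows "Re (\<Prod>p\<in>P. 1 + w p) \<ge> 0"
proof -
  have "norm ((\<Prod>p\<in>P. 1 + w p) - 1) \<le> (\<Prod>p\<in>P. 1 + norm (w p)) - 1"
    by (rule norm_prod_minus1_le_prod_minus1)
  also have "(\<Prod>p\<in>P. 1 + norm (w p)) \<le> exp (\<Sum>p\<in>P. norm (w p))"
    by (rule prod_le_exp_sum) auto
  also have "(\<Sum>p\<in>P. norm (w p)) \<le> (\<Sum>p\<in>P. 1 / (2 * real (card P)))"
    by (intro sum_mono assms)
  also have "\<dots> \<le> 1 / 2"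
    by simp
  also have "exp (1 / 2 :: real) \<le> 2"
    using exp_bound_half[of "1/2 :: real"] by simp
  finally have "norm ((\<Prod>p\<in>P. 1 + w p) - 1) \<le> 1"
    by simp
  then show ?thesis
    using abs_Re_le_cmod[of "(\<Prod>p\<in>P. 1 + w p) - 1"] by simp
qed

lemma weight_coeff_near_positive:
  assumes "prime p" "odd p" "t < p" "n > 0"
  shows "\<exists>r w. r \<ge> 0 \<and> norm w \<le> 1 / (2 * real n) \<and>
           weight_coeff (2 * real n * sqrt (real p)) p t = of_real r * (1 + w)"
proof (cases "t = 0")
  case True
  then show ?thesis
    by (intro exI[of _ "(2 * real n * sqrt (real p) + real p) / real p"] exI[of _ 0])
      (simp add: weight_coeff_0)
next
  case False
  define K where "K = 2 * real n * sqrt (real p)"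
  have p: "p > 0"
    using assms(3) by simp
  have K: "K > 0"
    using assms p by (simp add: K_def)
  have "norm (quad_sum p t / of_real K) = sqrt (real p) / K"
    using norm_quad_sum[of p t] assms False K by (simp add: norm_divide)
  also have "\<dots> = 1 / (2 * real n)"
    using p assms by (simp add: K_def)
  finally have "norm (quad_sum p t / of_real K) \<le> 1 / (2 * real n)"
    by simp
  moreover have "weight_coeff K p t = of_real (K / real p) * (1 + quad_sum p t / of_real K)"
    using K by (simp add: weight_coeff_def distrib_left add_divide_distrib)
  moreover have "K / real p \<ge> 0"
    using K by simp
  ultimately show ?thesis
    unfolding K_def[symmetric] by blast
qed

lemma Re_prod_weight_coeff_nonneg:
  assumes "finite P" "\<And>p. p \<in> P \<Longrightarrow> prime p \<and> odd p \<and> \<tau> p < p"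
  shows "Re (\<Prod>p\<in>P. weight_coeff (2 * real (card P) * sqrt (real p)) p (\<tau> p)) \<ge> 0"
proof -
  have "\<forall>p\<in>P. \<exists>r w. r \<ge> 0 \<and> norm w \<le> 1 / (2 * real (card P)) \<and>
           weight_coeff (2 * real (card P) * sqrt (real p)) p (\<tau> p) = of_real r * (1 + w)"
    using assms by (intro ballI weight_coeff_near_positive) (auto simp: card_gt_0_iff)
  then obtain r w where rw: "\<And>p. p \<in> P \<Longrightarrow> r p \<ge> 0"
    "\<And>p. p \<in> P \<Longrightarrow> norm (w p) \<le> 1 / (2 * real (card P))"
    "\<And>p. p \<in> P \<Longrightarrow> weight_coeff (2 * real (card P) * sqrt (real p)) p (\<tau> p) = of_real (r p) * (1 + w p)"
    by metis
  have "(\<Prod>p\<in>P. weight_coeff (2 * real (card P) * sqrt (real p)) p (\<tau> p)) =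
      of_real (\<Prod>p\<in>P. r p) * (\<Prod>p\<in>P. 1 + w p)"
    using rw(3) by (simp add: prod.distrib)
  then have "Re (\<Prod>p\<in>P. weight_coeff (2 * real (card P) * sqrt (real p)) p (\<tau> p)) =
      (\<Prod>p\<in>P. r p) * Re (\<Prod>p\<in>P. 1 + w p)"
    by (simp only: times_complex.sel Re_complex_of_real Im_complex_of_real mult_zero_left diff_zero)
  moreover have "(\<Prod>p\<in>P. r p) \<ge> 0"
    using rw(1) by (rule prod_nonneg)
  ultimately show ?thesis
    using Re_prod_near_1_nonneg[of P w] assms(1) rw(2) by (metis mult_nonneg_nonneg)
qed

section \<open>The Fourier bound for sets whose differences are nonsquares\<close>

lemma prod_addchar: "(\<Prod>p\<in>P. addchar p (f p * (a - b))) =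
   (\<Prod>p\<in>P. addchar p (f p * a)) * cnj (\<Prod>p\<in>P. addchar p (f p * b))"
  by (simp add: right_diff_distrib addchar_diff prod.distrib)

text \<open>
  Multiplying out the product over the primes produces one frequency vector \<open>\<tau>\<close> per term. The
  characters multiply to a character of the integers evaluated at \<open>a - b\<close>, so that the sum over
  \<open>a\<close> and \<open>b\<close> factors.
\<close>

lemma sum_prod_square_weight:
  assumes "finite P"
  shows "(\<Sum>a\<in>A. \<Sum>b\<in>A. \<Prod>p\<in>P. square_weight (K p) p (a - b)) =
    (\<Sum>\<tau>\<in>(\<Pi>\<^sub>E p\<in>P. {..<p}). (\<Prod>p\<in>P. weight_coeff (K p) p (\<tau> p)) *
        of_real ((norm (\<Sum>a\<in>A. \<Prod>p\<in>P. addchar p (int (\<tau> p) * a)))\<^sup>2))"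
proof -
  let ?T = "\<Pi>\<^sub>E p\<in>P. {..<p}"
  let ?g = "\<lambda>\<tau>. \<Prod>p\<in>P. weight_coeff (K p) p (\<tau> p)"
  let ?e = "\<lambda>\<tau> a. \<Prod>p\<in>P. addchar p (int (\<tau> p) * a)"
  have "(\<Prod>p\<in>P. square_weight (K p) p (a - b)) = (\<Sum>\<tau>\<in>?T. ?g \<tau> * (?e \<tau> a * cnj (?e \<tau> b)))" for a b
    unfolding square_weight_def
    by (subst prod_sum_PiE[OF assms]) (simp_all only: finite_lessThan prod.distrib prod_addchar)
  then have "(\<Sum>a\<in>A. \<Sum>b\<in>A. \<Prod>p\<in>P. square_weight (K p) p (a - b)) =
      (\<Sum>a\<in>A. \<Sum>b\<in>A. \<Sum>\<tau>\<in>?T. ?g \<tau> * (?e \<tau> a * cnj (?e \<tau> b)))"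
    by simp
  also have "\<dots> = (\<Sum>\<tau>\<in>?T. \<Sum>a\<in>A. \<Sum>b\<in>A. ?g \<tau> * (?e \<tau> a * cnj (?e \<tau> b)))"
    unfolding sum.swap[of _ ?T A] by (rule refl)
  also have "\<dots> = (\<Sum>\<tau>\<in>?T. ?g \<tau> * ((\<Sum>a\<in>A. ?e \<tau> a) * cnj (\<Sum>b\<in>A. ?e \<tau> b)))"
    by (simp only: sum_product cnj_sum) (simp only: sum_distrib_left)
  also have "\<dots> = (\<Sum>\<tau>\<in>?T. ?g \<tau> * of_real ((norm (\<Sum>a\<in>A. ?e \<tau> a))\<^sup>2))"
    by (simp only: complex_norm_square)
  finally show ?thesis .
qed

text \<open>
  The two evaluations of the sum of \<open>\<Prod>p\<in>P. square_weight (K p) p (a - b)\<close> over all pairs from \<open>A\<close>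
  are compared: only the diagonal contributes on the one side, and the zero frequency is a lower
  bound on the other.
\<close>

lemma card_le_prod:
  fixes A :: "int set" and P :: "nat set"
  assumes P: "finite P" "\<And>p. p \<in> P \<Longrightarrow> prime p \<and> odd p"
    and A: "finite A"
    and nonsquare: "\<And>a b. a \<in> A \<Longrightarrow> b \<in> A \<Longrightarrow> a \<noteq> b \<Longrightarrow>
      \<exists>p\<in>P. \<not> (\<exists>y. [a - b = y\<^sup>2] (mod int p))"
  shows "real (card A) \<le> (\<Prod>p\<in>P. 2 * real (card P) * sqrt (real p) + 1)"
proof -
  define K where "K = (\<lambda>p. 2 * real (card P) * sqrt (real p))"
  let ?T = "\<Pi>\<^sub>E p\<in>P. {..<p}"
  let ?g = "\<lambda>\<tau>. \<Prod>p\<in>P. weight_coeff (K p) p (\<tau> p)"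
  let ?h = "\<lambda>\<tau>. (norm (\<Sum>a\<in>A. \<Prod>p\<in>P. addchar p (int (\<tau> p) * a)))\<^sup>2"
  let ?o = "\<lambda>p\<in>P. 0 :: nat"
  have pos: "p > 0" if "p \<in> P" for p
    using P(2)[OF that] by (simp add: prime_gt_0_nat)
  have T: "finite ?T" "?o \<in> ?T"
    using P(1) pos by (auto intro!: finite_PiE)
  have diag: "(\<Prod>p\<in>P. square_weight (K p) p (a - b)) = (if a = b then of_real (\<Prod>p\<in>P. K p + 1) else 0)"
    if ab: "a \<in> A" "b \<in> A" for a b
  proof (cases "a = b")
    case True
    then show ?thesis
      using P(2) by (simp add: square_weight_0)
  next
    case False
    then obtain p where "p \<in> P" "\<not> (\<exists>y. [a - b = y\<^sup>2] (mod int p))"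
      using nonsquare ab by blast
    then have "square_weight (K p) p (a - b) = 0"
      using square_weight_nonsquare pos by blast
    then show ?thesis
      using False P(1) \<open>p \<in> P\<close> by auto
  qed
  have "(\<Sum>a\<in>A. \<Sum>b\<in>A. \<Prod>p\<in>P. square_weight (K p) p (a - b)) = of_real (real (card A) * (\<Prod>p\<in>P. K p + 1))"
    using A by (simp add: diag sum.delta cong: sum.cong)
  then have "complex_of_real (real (card A) * (\<Prod>p\<in>P. K p + 1)) = (\<Sum>\<tau>\<in>?T. ?g \<tau> * of_real (?h \<tau>))"
    using sum_prod_square_weight[OF P(1), of K A] by simp
  then have "Re (complex_of_real (real (card A) * (\<Prod>p\<in>P. K p + 1))) =
      Re (\<Sum>\<tau>\<in>?T. ?g \<tau> * of_real (?h \<tau>))"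
    by (rule arg_cong)
  then have "real (card A) * (\<Prod>p\<in>P. K p + 1) = (\<Sum>\<tau>\<in>?T. Re (?g \<tau>) * ?h \<tau>)"
    by (simp only: times_complex.sel Re_sum Re_complex_of_real Im_complex_of_real mult_zero_right diff_zero)
  also have "\<dots> \<ge> Re (?g ?o) * ?h ?o"
  proof (rule member_le_sum[OF T(2) _ T(1)])
    fix \<tau> assume "\<tau> \<in> ?T - {?o}"
    then have "Re (?g \<tau>) \<ge> 0"
      unfolding K_def using P by (intro Re_prod_weight_coeff_nonneg) auto
    then show "Re (?g \<tau>) * ?h \<tau> \<ge> 0"
      by simp
  qed
  also have "?h ?o = (real (card A))\<^sup>2"
    by simp
  finally have 1: "Re (?g ?o) * (real (card A))\<^sup>2 \<le> real (card A) * (\<Prod>p\<in>P. K p + 1)" .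
  have "?g ?o = of_real (\<Prod>p\<in>P. (K p + real p) / real p)"
    by (simp add: weight_coeff_0)
  then have "Re (?g ?o) = (\<Prod>p\<in>P. (K p + real p) / real p)"
    by (simp only: Re_complex_of_real)
  also have "\<dots> \<ge> 1"
    using pos by (intro prod_ge_1) (auto simp: K_def field_simps)
  finally have "Re (?g ?o) \<ge> 1" .
  then have "1 * (real (card A))\<^sup>2 \<le> Re (?g ?o) * (real (card A))\<^sup>2"
    by (intro mult_right_mono) auto
  with 1 have "real (card A) * real (card A) \<le> real (card A) * (\<Prod>p\<in>P. K p + 1)"
    by (simp add: power2_eq_square)
  moreover have "(\<Prod>p\<in>P. K p + 1) \<ge> 0"
    by (intro prod_nonneg) (simp add: K_def)
  ultimately show ?thesis
    unfolding K_def by (cases "card A = 0") auto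
qed

section \<open>Squares modulo a squarefree number\<close>

lemma squarefree_multiplicity_prime_factor:
  fixes m :: nat
  assumes "squarefree m" "p \<in> prime_factors m"
  shows "multiplicity p m = 1"
proof -
  have "multiplicity p m > 0"
    using assms(2) by (simp add: prime_factors_multiplicity)
  moreover have "multiplicity p m \<le> 1"
    using assms by (metis One_nat_def in_prime_factors_imp_prime not_squarefree_0 squarefree_factorial_semiring'')
  ultimately show ?thesis
    by simp
qed

lemma squarefree_prod_prime_divisors:
  fixes m :: nat
  assumes "squarefree m"
  shows "\<Prod>{p. prime p \<and> p dvd m} = m"
proof -
  have m: "m \<noteq> 0"
    using assms by (metis not_squarefree_0)
  have "m = (\<Prod>p\<in>prime_factors m. p ^ multiplicity p m)"
    using prod_prime_factors[OF m] by simp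
  also have "\<dots> = \<Prod>(prime_factors m)"
    using assms by (intro prod.cong) (simp_all add: squarefree_multiplicity_prime_factor)
  finally show ?thesis
    using m by (simp add: prime_factors_dvd)
qed

text \<open>
  The odd primes suffice because every residue mod 2 is a square. The local roots are glued by the
  Chinese remainder theorem.
\<close>

lemma square_mod_squarefree:
  fixes m :: nat
  assumes m: "squarefree m"
    and sq: "\<And>p. prime p \<Longrightarrow> odd p \<Longrightarrow> p dvd m \<Longrightarrow> \<exists>y. [x = y\<^sup>2] (mod int p)"
  shows "\<exists>y. [x = y\<^sup>2] (mod int m)"
proof -
  let ?Q = "{p. prime p \<and> p dvd m}"
  have m0: "m > 0"
    using m by (metis not_squarefree_0 gr0I)
  have fin: "finite ?Q"
    using m0 by (auto intro: finite_subset[OF _ finite_divisors_nat])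
  have cop: "\<forall>p\<in>?Q. \<forall>q\<in>?Q. p \<noteq> q \<longrightarrow> coprime p q"
    using primes_coprime by blast
  have "\<forall>p\<in>?Q. \<exists>y :: nat. [x = (int y)\<^sup>2] (mod int p)"
  proof
    fix p assume p: "p \<in> ?Q"
    have "\<exists>y. [x = y\<^sup>2] (mod int p)"
    proof (cases "odd p")
      case False
      then have "p = 2"
        using p prime_odd_nat[of p] by (metis mem_Collect_eq prime_ge_2_nat le_less)
      moreover have "[x = x\<^sup>2] (mod 2)"
        by (simp add: cong_iff_dvd_diff)
      ultimately show ?thesis
        by auto
    qed (use sq p in auto)
    then obtain y where y: "[x = y\<^sup>2] (mod int p)"
      by blast
    have "p > 0"
      using p by (simp add: prime_gt_0_nat)
    then have "[y\<^sup>2 = (int (nat (y mod int p)))\<^sup>2] (mod int p)"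
      by (intro cong_pow) (simp add: cong_def)
    then show "\<exists>y :: nat. [x = (int y)\<^sup>2] (mod int p)"
      using y cong_trans by blast
  qed
  then obtain u :: "nat \<Rightarrow> nat" where u: "\<And>p. p \<in> ?Q \<Longrightarrow> [x = (int (u p))\<^sup>2] (mod int p)"
    by metis
  obtain z :: nat where z: "\<And>p. p \<in> ?Q \<Longrightarrow> [z = u p] (mod p)"
    using chinese_remainder_nat[OF fin, of "\<lambda>p. p" u] cop by blast
  have "[x = (int z)\<^sup>2] (mod int p)" if "p \<in> ?Q" for p
    using u[OF that] z[OF that] by (metis cong_int_iff cong_pow cong_sym cong_trans)
  then have "[x = (int z)\<^sup>2] (mod (\<Prod>p\<in>?Q. int p))"
    using cop by (intro cong_cong_prod_coprime) auto
  moreover have "(\<Prod>p\<in>?Q. int p) = int m"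
    using arg_cong[OF squarefree_prod_prime_divisors[OF m], of int] by (simp only: of_nat_prod)
  ultimately have "[x = (int z)\<^sup>2] (mod int m)"
    by (simp only:)
  then show ?thesis
    by (rule exI)
qed

section \<open>The explicit bound and its asymptotic consequences\<close>

text \<open>
  Each factor \<open>2 * n * sqrt p + 1\<close> of the Fourier bound is at most \<open>3 * n * sqrt p\<close>, and the product
  of the odd primes dividing \<open>m\<close> is at most \<open>m\<close>. For \<open>n = 0\<close> the products are empty, in agreement
  with the value 1 of \<open>0 ^ 0\<close>.
\<close>

theorem card_no_square_differences_le:
  fixes m :: nat and A :: "int set"
  assumes m: "squarefree m" "m > 1"
    and A: "A \<subseteq> carrier (residue_ring (int m))" "no_nonzero_square_differences (residue_ring (int m)) A"
  defines "n \<equiv> num_odd_prime_divisors m"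
  shows "real (card A) \<le> sqrt (real m) * (3 * real n) ^ n"
proof -
  define P where "P = {p. prime p \<and> odd p \<and> p dvd m}"
  have n: "n = card P"
    by (simp add: n_def P_def num_odd_prime_divisors_def)
  have fin: "finite P"
    using m by (auto simp: P_def intro: finite_subset[OF _ finite_divisors_nat[of m]])
  have "finite A"
    using A(1) by (rule finite_subset) (simp add: residue_ring_def)
  moreover have "\<exists>p\<in>P. \<not> (\<exists>y. [a - b = y\<^sup>2] (mod int p))" if "a \<in> A" "b \<in> A" "a \<noteq> b" for a b
  proof -
    have "\<not> (\<exists>y. [a - b = y\<^sup>2] (mod int m))"
      using that A(2) m(2) no_nonzero_square_differences_residue_ring[OF _ A(1)] by simp
    then show ?thesis
      using square_mod_squarefree[OF m(1), of "a - b"] by (auto simp: P_def)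
  qed
  ultimately have "real (card A) \<le> (\<Prod>p\<in>P. 2 * real n * sqrt (real p) + 1)"
    unfolding n using fin by (intro card_le_prod) (auto simp: P_def)
  also have "\<dots> \<le> (\<Prod>p\<in>P. sqrt (real p) * (3 * real n))"
  proof (intro prod_mono conjI)
    fix p assume p: "p \<in> P"
    then have "n \<ge> 1"
      using fin n by (metis One_nat_def Suc_leI card_gt_0_iff empty_iff)
    moreover have "sqrt (real p) \<ge> 1"
      using p by (simp add: P_def prime_gt_0_nat Suc_leI)
    ultimately have "1 * 1 \<le> real n * sqrt (real p)"
      by (intro mult_mono) auto
    then show "2 * real n * sqrt (real p) + 1 \<le> sqrt (real p) * (3 * real n)"
      by (simp add: algebra_simps)
  qed auto
  also have "\<dots> = sqrt (real (\<Prod>P)) * (3 * real n) ^ n"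
  proof -
    have "(\<Prod>p\<in>P. sqrt (real p)) = sqrt (real (\<Prod>P))"
      using fin by induction (auto simp: real_sqrt_mult)
    then show ?thesis
      by (simp add: prod.distrib n)
  qed
  also have "\<dots> \<le> sqrt (real m) * (3 * real n) ^ n"
  proof -
    have "\<Prod>P dvd \<Prod>{p. prime p \<and> p dvd m}"
      using m by (intro prod_dvd_prod_subset) (auto simp: P_def intro: finite_subset[OF _ finite_divisors_nat[of m]])
    then have "\<Prod>P \<le> m"
      using m by (simp add: squarefree_prod_prime_divisors dvd_imp_le)
    then have "real (\<Prod>P) \<le> real m"
      by (simp only: of_nat_le_iff)
    then show ?thesis
      by (intro mult_right_mono) (simp_all only: real_sqrt_le_iff, simp)
  qed
  finally show ?thesis .
qed

text \<open>
  This form serves both asymptotic regimes. The bound \<open>\<theta> \<le> 1/3\<close> is exactly what gives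
  \<open>3 * n \<le> ln m\<close>, and then \<open>(3 * n) ^ n \<le> exp (n * ln (ln m)) \<le> m powr \<theta>\<close>.
\<close>

lemma card_no_square_differences_le_powr:
  fixes m :: nat and A :: "int set"
  assumes m: "squarefree m" "m > 1" "ln (ln (real m)) \<ge> 1"
    and A: "A \<subseteq> carrier (residue_ring (int m))" "no_nonzero_square_differences (residue_ring (int m)) A"
    and n: "real (num_odd_prime_divisors m) * ln (ln (real m)) \<le> \<theta> * ln (real m)" "\<theta> \<le> 1 / 3"
  shows "real (card A) \<le> real m powr (1 / 2 + \<theta>)"
proof -
  define n' where "n' = num_odd_prime_divisors m"
  have L: "ln (real m) > 0"
    using m(2) by simp
  have "(3 * real n') ^ n' \<le> real m powr \<theta>"
  proof (cases "n' = 0")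
    case True
    with n L have "\<theta> \<ge> 0"
      by (simp add: n'_def zero_le_mult_iff)
    with True m(2) show ?thesis
      by (simp add: ge_one_powr_ge_zero)
  next
    case False
    have "real n' * 1 \<le> real n' * ln (ln (real m))"
      using m(3) by (intro mult_left_mono) auto
    also have "\<dots> \<le> \<theta> * ln (real m)"
      using n(1) by (simp add: n'_def)
    also have "\<dots> \<le> 1 / 3 * ln (real m)"
      using n(2) L by (intro mult_right_mono) auto
    finally have "3 * real n' \<le> ln (real m)"
      by simp
    then have "(3 * real n') ^ n' \<le> ln (real m) ^ n'"
      by (intro power_mono) auto
    also have "\<dots> = exp (real n' * ln (ln (real m)))"
      using L by (simp add: exp_of_nat_mult)
    also have "\<dots> \<le> exp (\<theta> * ln (real m))"
      using n(1) by (simp add: n'_def)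
    also have "\<dots> = real m powr \<theta>"
      using m(2) by (simp add: powr_def)
    finally show ?thesis .
  qed
  then have "sqrt (real m) * (3 * real n') ^ n' \<le> real m powr (1 / 2) * real m powr \<theta>"
    using m(2) by (intro mult_mono) (auto simp: powr_half_sqrt)
  then show ?thesis
    using card_no_square_differences_le[OF m(1,2) A] by (simp add: n'_def powr_add)
qed

lemma filterlim_ln_ln_nat: "filterlim (\<lambda>m::nat. ln (ln (real m))) at_top at_top"
  by (intro filterlim_compose[OF ln_at_top] filterlim_real_sequentially)

theorem corollary1:
  shows
    "(\<forall>(m :: nat \<Rightarrow> nat) (A :: nat \<Rightarrow> int set).
       (\<forall>k. squarefree (m k)) \<longrightarrow>
       filterlim m at_top sequentially \<longrightarrow>
       (\<lambda>k. real (num_odd_prime_divisors (m k)) * ln (ln (real (m k))) / ln (real (m k)))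
         \<longlonglongrightarrow> 0 \<longrightarrow>
       (\<forall>k. A k \<subseteq> carrier (residue_ring (int (m k))) \<and>
            no_nonzero_square_differences (residue_ring (int (m k))) (A k)) \<longrightarrow>
       (\<forall>\<delta>::real. \<delta> > 0 \<longrightarrow>
          (\<forall>\<^sub>F k in sequentially. real (card (A k)) \<le> real (m k) powr (1 / 2 + \<delta>))))
     \<and>
     (\<forall>\<epsilon>::real. \<epsilon> > 0 \<longrightarrow>
       (\<forall>\<delta>::real. \<delta> > 0 \<longrightarrow>
          (\<exists>m0::nat. \<forall>m\<ge>m0. squarefree m \<longrightarrow>
             real (num_odd_prime_divisors m)
               \<le> (1 / 3 - \<epsilon>) * (ln (real m) / ln (ln (real m))) \<longrightarrow>
             (\<forall>A::int set. A \<subseteq> carrier (residue_ring (int m)) \<longrightarrow>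
                no_nonzero_square_differences (residue_ring (int m)) A \<longrightarrow>
                real (card A) \<le> real m powr (1 - 1.5 * \<epsilon> + \<delta>)))))"
proof -
  have large: "\<forall>\<^sub>F m::nat in at_top. m > 1 \<and> ln (ln (real m)) \<ge> 1"
    using filterlim_ln_ln_nat eventually_gt_at_top[of 1]
    by (auto simp: filterlim_at_top eventually_conj_iff)
  show ?thesis
  proof (intro conjI allI impI)
    fix m :: "nat \<Rightarrow> nat" and A :: "nat \<Rightarrow> int set" and \<delta> :: real
    assume sf: "\<forall>k. squarefree (m k)"
      and lim: "filterlim m at_top sequentially"
      and n: "(\<lambda>k. real (num_odd_prime_divisors (m k)) * ln (ln (real (m k))) / ln (real (m k)))
         \<longlonglongrightarrow> 0"
      and A: "\<forall>k. A k \<subseteq> carrier (residue_ring (int (m k))) \<and>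
            no_nonzero_square_differences (residue_ring (int (m k))) (A k)"
      and \<delta>: "\<delta> > 0"
    \<comment> \<open>The cap at 1/3 meets the hypothesis of \<open>card_no_square_differences_le_powr\<close>.\<close>
    define \<theta> where "\<theta> = min \<delta> (1 / 3)"
    have "\<theta> > 0"
      using \<delta> by (simp add: \<theta>_def)
    then have "\<forall>\<^sub>F k in sequentially.
        real (num_odd_prime_divisors (m k)) * ln (ln (real (m k))) / ln (real (m k)) < \<theta>"
      using n by (rule order_tendstoD(2)[rotated])
    moreover have "\<forall>\<^sub>F k in sequentially. m k > 1 \<and> ln (ln (real (m k))) \<ge> 1"
      using large lim by (rule eventually_compose_filterlim)
    ultimately show "\<forall>\<^sub>F k in sequentially. real (card (A k)) \<le> real (m k) powr (1 / 2 + \<delta>)"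
    proof eventually_elim
      case (elim k)
      have "ln (real (m k)) > 0"
        using elim by simp
      then have "real (num_odd_prime_divisors (m k)) * ln (ln (real (m k))) \<le> \<theta> * ln (real (m k))"
        using elim by (simp add: pos_divide_less_eq)
      then have "real (card (A k)) \<le> real (m k) powr (1 / 2 + \<theta>)"
        using elim sf A by (intro card_no_square_differences_le_powr) (auto simp: \<theta>_def)
      also have "\<dots> \<le> real (m k) powr (1 / 2 + \<delta>)"
        using elim by (intro powr_mono) (auto simp: \<theta>_def)
      finally show ?case .
    qed
  next
    fix \<epsilon> \<delta> :: real
    assume \<epsilon>: "\<epsilon> > 0" and \<delta>: "\<delta> > 0"
    obtain m0 :: nat where m0: "\<And>m. m \<ge> m0 \<Longrightarrow> m > 1 \<and> ln (ln (real m)) \<ge> 1"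
      using large unfolding eventually_sequentially by blast
    show "\<exists>m0::nat. \<forall>m\<ge>m0. squarefree m \<longrightarrow>
             real (num_odd_prime_divisors m)
               \<le> (1 / 3 - \<epsilon>) * (ln (real m) / ln (ln (real m))) \<longrightarrow>
             (\<forall>A::int set. A \<subseteq> carrier (residue_ring (int m)) \<longrightarrow>
                no_nonzero_square_differences (residue_ring (int m)) A \<longrightarrow>
                real (card A) \<le> real m powr (1 - 1.5 * \<epsilon> + \<delta>))"
    proof (intro exI[of _ m0] allI impI)
      fix m :: nat and A :: "int set"
      assume "m0 \<le> m" and sf: "squarefree m"
        and n: "real (num_odd_prime_divisors m) \<le> (1 / 3 - \<epsilon>) * (ln (real m) / ln (ln (real m)))"
        and A: "A \<subseteq> carrier (residue_ring (int m))"
          "no_nonzero_square_differences (residue_ring (int m)) A"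
      then have m: "m > 1" "ln (ln (real m)) \<ge> 1"
        using m0 by auto
      have L: "ln (real m) > 0"
        using m(1) by simp
      then have pos: "ln (real m) / ln (ln (real m)) > 0"
        using m(2) by (intro divide_pos_pos) linarith+
      \<comment> \<open>For \<open>\<epsilon> > 1/3\<close> the hypothesis would make a cardinality negative.\<close>
      have "0 \<le> (1 / 3 - \<epsilon>) * (ln (real m) / ln (ln (real m)))"
        using n by (rule order_trans[rotated]) simp
      with pos have \<epsilon>_le: "\<epsilon> \<le> 1 / 3"
        using mult_neg_pos[of "1 / 3 - \<epsilon>" "ln (real m) / ln (ln (real m))"] by linarith
      have "real (num_odd_prime_divisors m) \<le> ((1 / 3 - \<epsilon>) * ln (real m)) / ln (ln (real m))"
        using n by simp
      moreover have "ln (ln (real m)) > 0"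
        using m(2) by linarith
      ultimately have "real (num_odd_prime_divisors m) * ln (ln (real m)) \<le> (1 / 3 - \<epsilon>) * ln (real m)"
        by (simp only: pos_le_divide_eq)
      then have "real (card A) \<le> real m powr (1 / 2 + (1 / 3 - \<epsilon>))"
        using m \<epsilon> sf A by (intro card_no_square_differences_le_powr) auto
      also have "\<dots> \<le> real m powr (1 - 1.5 * \<epsilon> + \<delta>)"
        using m \<epsilon>_le \<delta> by (intro powr_mono) auto
      finally show "real (card A) \<le> real m powr (1 - 1.5 * \<epsilon> + \<delta>)" .
    qed
  qed
qed

end
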